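(* Let $V$ be a vertex operator algebra with non-degenerate Li-Zamolodchikov metric. Consider the torus obtained by self-sewing the Riemann sphere with punctures at $0$ and $w$ via $z_1z_2=\rho$ (with $z_1=z$ near $0$, $z_2=z-w$ near $w$), and the associated genus one partition function $$Z_{V,\rho}^{(1)}(\rho,w)=\sum_{n\ge0}\rho^n\sum_{u\in V_n}\mathrm{Res}_{z_2=0}z_2^{-1}\mathrm{Res}_{z_1=0}z_1^{-1}\langle\mathbf 1,Y(u,w+z_2)Y(\bar u,z_1)\mathbf 1\rangle .$$ Then $$Z_{V,\rho}^{(1)}(\rho,w)=Z_V^{(1)}(q),\qquad q=f(\chi),\quad \chi=-\frac{\rho}{w^2},$$ where $f(\chi)=\frac{1-\sqrt{1-4\chi}}{2\chi}-1=\sum_{n\ge1}\frac1n\binom{2n}{n+1}\chi^n$ is the Catalan series.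
   Context: $V=\bigoplus_{n\ge0}V_n$ is a VOA with $V_0=\mathbb C\mathbf 1$ and finite-dimensional homogeneous spaces. Its Li-Zamolodchikov (LiZ) metric $\langle\,,\rangle$ is the unique bilinear form with $\langle\mathbf 1,\mathbf 1\rangle=1$ that is invariant: $\langle Y(a,z)b,c\rangle=\langle b,Y(e^{zL(1)}(-z^{-2})^{L(0)}a,z^{-1})c\rangle$; it is assumed to exist and be non-degenerate. For each $n$ the inner sum is over any basis $\{u\}$ of $V_n$, and $\{\bar u\}$ is the dual basis with respect to $\langle\,,\rangle$. $Z_V^{(1)}(q)=\sum_{n\ge0}\dim V_n\,q^n=Tr_V(q^{L(0)})$ (no factor $q^{-c/24}$). Equality may be read as an identity of power series in $\chi$ (the sewing is geometrically defined for $|\chi|<\frac14$). *)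

theory Defs
  imports
    Complex_Main
    "HOL-Library.Groups_Big_Fun"
    "HOL-Computational_Algebra.Formal_Power_Series"
begin

text \<open>
  A vertex operator is given by its modes: \<open>Y u n\<close> is the endomorphism \<open>u(n)\<close> in
  \<open>Y(u,z) = \<Sum>n. u(n) z^(-n-1)\<close>.  \<open>Sum_any\<close> is the sum over the support of its argument; by
  the truncation axiom (and, for expressions in homogeneous states, by the grading)
  the support is finite wherever it is used below.
\<close>

text \<open>\<open>L(n)\<close>, from \<open>Y(\<omega>,z) = \<Sum>n. L(n) z^(-n-2)\<close>.\<close>

definition virasoro_mode :: "('v \<Rightarrow> int \<Rightarrow> 'v \<Rightarrow> 'v) \<Rightarrow> 'v \<Rightarrow> int \<Rightarrow> 'v \<Rightarrow> 'v" where
  "virasoro_mode Y \<omega> n = Y \<omega> (n + 1)"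

text \<open>
  The Jacobi identity appears as \<open>borcherds\<close>, its component form in modes.
\<close>

locale vertex_operator_algebra = vector_space scale
  for scale :: "complex \<Rightarrow> 'v::ab_group_add \<Rightarrow> 'v" +
  fixes V :: "nat \<Rightarrow> 'v set"
    and Y :: "'v \<Rightarrow> int \<Rightarrow> 'v \<Rightarrow> 'v"
    and vac :: 'v
    and \<omega> :: 'v
    and c :: complex
  assumes grade_subspace: "subspace (V n)"
    and grade_finite_dim: "\<exists>B. finite B \<and> span B = V n"
    and grade_decomposition:
      "\<exists>!f. (\<forall>n. f n \<in> V n) \<and> finite {n. f n \<noteq> 0} \<and> v = (\<Sum>n | f n \<noteq> 0. f n)"
    and vacuum_grade: "vac \<in> V 0"
    and conformal_grade: "\<omega> \<in> V 2"
    and mode_linear: "Vector_Spaces.linear scale scale (Y u n)"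
    and state_linear: "Vector_Spaces.linear scale scale (\<lambda>u. Y u n v)"
    and truncation: "\<exists>N. \<forall>n\<ge>N. Y u n v = 0"
    and vacuum_identity: "Y vac n v = (if n = -1 then v else 0)"
    and creation_regular: "n \<ge> 0 \<Longrightarrow> Y u n vac = 0"
    and creation: "Y u (-1) vac = u"
    and borcherds:
      "Sum_any (\<lambda>j::nat. scale (of_int m gchoose j) (Y (Y a (n + int j) b) (m + k - int j) v))
       = Sum_any (\<lambda>j::nat. scale ((-1) ^ j * (of_int n gchoose j))
           (Y a (m + n - int j) (Y b (k + int j) v)
            - scale ((-1) powi n) (Y b (n + k - int j) (Y a (m + int j) v))))"
    and virasoro:
      "virasoro_mode Y \<omega> m (virasoro_mode Y \<omega> n v) - virasoro_mode Y \<omega> n (virasoro_mode Y \<omega> m v)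
       = scale (of_int (m - n)) (virasoro_mode Y \<omega> (m + n) v)
         + scale (if m + n = 0 then of_int (m ^ 3 - m) / 12 * c else 0) v"
    and L0_grading: "v \<in> V k \<Longrightarrow> virasoro_mode Y \<omega> 0 v = scale (of_nat k) v"
    and translation: "Y (virasoro_mode Y \<omega> (-1) u) n v = scale (- of_int n) (Y u (n - 1) v)"

text \<open>
  For \<open>a\<close> of weight \<open>k\<close>,
  \<open>Y(e^(zL(1)) (-z^(-2))^L(0) a, z^(-1))
    = (-1)^k \<Sum>j n. (1/j!) (L(1)^j a)(n) z^(j - 2k + n + 1)\<close>,
  and \<open>adjoint_coeff scale Y \<omega> k a p\<close> is the coefficient of \<open>z^p\<close>.
\<close>

definition adjoint_coeff ::
    "(complex \<Rightarrow> 'v::ab_group_add \<Rightarrow> 'v) \<Rightarrow> ('v \<Rightarrow> int \<Rightarrow> 'v \<Rightarrow> 'v) \<Rightarrow> 'v \<Rightarrow> nat \<Rightarrow> 'v \<Rightarrow> int \<Rightarrow> 'v \<Rightarrow> 'v"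
  where
  "adjoint_coeff scale Y \<omega> k a p v =
     scale ((-1) ^ k)
       (Sum_any (\<lambda>j::nat. scale (1 / fact j)
          (Y ((virasoro_mode Y \<omega> 1 ^^ j) a) (p - int j + 2 * int k - 1) v)))"

text \<open>
  In \<open>invariant\<close>, both sides are coefficients of \<open>z^p\<close>; that of \<open>Y(a,z)\<close> is \<open>a(-p-1)\<close>.
  The states \<open>a\<close> are taken homogeneous, which suffices by linearity.
\<close>

locale li_zamolodchikov_metric = vertex_operator_algebra scale V Y vac \<omega> c
  for scale :: "complex \<Rightarrow> 'v::ab_group_add \<Rightarrow> 'v" and V Y vac \<omega> c +
  fixes form :: "'v \<Rightarrow> 'v \<Rightarrow> complex"
  assumes form_linear_left: "Vector_Spaces.linear scale (*) (\<lambda>u. form u v)"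
    and form_linear_right: "Vector_Spaces.linear scale (*) (form u)"
    and form_vacuum: "form vac vac = 1"
    and invariant:
      "a \<in> V k \<Longrightarrow> form (Y a (- p - 1) u) v = form u (adjoint_coeff scale Y \<omega> k a p v)"

definition nondegenerate :: "('v::zero \<Rightarrow> 'v \<Rightarrow> complex) \<Rightarrow> bool" where
  "nondegenerate form \<longleftrightarrow>
     (\<forall>u. (\<forall>v. form u v = 0) \<longrightarrow> u = 0) \<and> (\<forall>v. (\<forall>u. form u v = 0) \<longrightarrow> v = 0)"

definition graded_basis ::
    "(complex \<Rightarrow> 'v::ab_group_add \<Rightarrow> 'v) \<Rightarrow> (nat \<Rightarrow> 'v set) \<Rightarrow> (nat \<Rightarrow> 'v set) \<Rightarrow> bool" where
  "graded_basis scale V B \<longleftrightarrow>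
     (\<forall>n. \<not> module.dependent scale (B n) \<and> module.span scale (B n) = V n)"

definition dual_basis ::
    "('v \<Rightarrow> 'v \<Rightarrow> complex) \<Rightarrow> (nat \<Rightarrow> 'v set) \<Rightarrow> (nat \<Rightarrow> 'v set) \<Rightarrow> ('v \<Rightarrow> 'v) \<Rightarrow> bool" where
  "dual_basis form V B dual \<longleftrightarrow>
     (\<forall>n. \<forall>u\<in>B n. dual u \<in> V n \<and> (\<forall>v\<in>B n. form v (dual u) = (if v = u then 1 else 0)))"

text \<open>
  Formal distributions: \<open>F :: int \<Rightarrow> complex\<close> stands for \<open>\<Sum>n. F n z^n\<close>.
\<close>

definition formal_residue :: "(int \<Rightarrow> complex) \<Rightarrow> complex" where
  "formal_residue F = F (-1)"

text \<open>Multiplication by \<open>z^k\<close>.\<close>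

definition times_monomial :: "int \<Rightarrow> (int \<Rightarrow> complex) \<Rightarrow> int \<Rightarrow> complex" where
  "times_monomial k F = (\<lambda>n. F (n - k))"

text \<open>
  \<open>F(w + z)\<close> as a series in \<open>z\<close>, where every \<open>(w + z)^m\<close> is expanded in nonnegative
  powers of \<open>z\<close>: \<open>(w + z)^m = \<Sum>i\<ge>0. (m choose i) w^(m-i) z^i\<close>.
\<close>

definition expand_at :: "complex \<Rightarrow> (int \<Rightarrow> complex) \<Rightarrow> int \<Rightarrow> complex" where
  "expand_at w F i =
     (if i < 0 then 0
      else Sum_any (\<lambda>m::int. F m * (of_int m gchoose nat i) * w powi (m - i)))"

text \<open>Coefficient of \<open>x^m y^l\<close> in \<open>\<langle>1, Y(u,x) Y(v,y) 1\<rangle>\<close>.\<close>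

definition two_point ::
    "('v \<Rightarrow> 'v \<Rightarrow> complex) \<Rightarrow> ('v \<Rightarrow> int \<Rightarrow> 'v \<Rightarrow> 'v) \<Rightarrow> 'v \<Rightarrow> 'v \<Rightarrow> 'v \<Rightarrow> int \<Rightarrow> int \<Rightarrow> complex" where
  "two_point form Y vac u v m l = form vac (Y u (- m - 1) (Y v (- l - 1) vac))"

text \<open>
  The sum over \<open>n\<close> of \<open>\<rho>^n \<Sum>u. Res_z2 z2^(-1) Res_z1 z1^(-1) \<langle>1, Y(u,w+z2) Y(dual u,z1) 1\<rangle>\<close>,
  as a power series in \<open>\<rho>\<close> for a fixed puncture \<open>w\<close>.  Below, \<open>i\<close> and \<open>l\<close> are the exponents of
  \<open>z2\<close> and \<open>z1\<close>.
\<close>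

definition sewn_partition_function ::
    "('v \<Rightarrow> 'v \<Rightarrow> complex) \<Rightarrow> ('v \<Rightarrow> int \<Rightarrow> 'v \<Rightarrow> 'v) \<Rightarrow> 'v \<Rightarrow> (nat \<Rightarrow> 'v set) \<Rightarrow> ('v \<Rightarrow> 'v) \<Rightarrow> complex
      \<Rightarrow> complex fps" where
  "sewn_partition_function form Y vac B dual w =
     Abs_fps (\<lambda>n. \<Sum>u\<in>B n.
       formal_residue (times_monomial (-1) (\<lambda>i.
         formal_residue (times_monomial (-1) (\<lambda>l.
           expand_at w (\<lambda>m. two_point form Y vac u (dual u) m l) i)))))"

definition graded_dimension ::
    "(complex \<Rightarrow> 'v::ab_group_add \<Rightarrow> 'v) \<Rightarrow> (nat \<Rightarrow> 'v set) \<Rightarrow> complex fps" where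
  "graded_dimension scale V = Abs_fps (\<lambda>n. of_nat (vector_space.dim scale (V n)))"

text \<open>
  The fps square root is the one with constant coefficient \<open>csqrt 1 = 1\<close>; the numerator has
  no constant term, so the division by \<open>2\<chi>\<close> is exact.
\<close>

definition catalan_series :: "complex fps" where
  "catalan_series =
     (1 - fps_radical (\<lambda>_. csqrt) 2 (1 - 4 * fps_X)) / (2 * fps_X) - 1"

end

theory Submission
  imports Defs
begin

text \<open>
  The coefficient of \<open>\<rho>^n\<close> is \<open>w^(-2n) \<Sum>u. \<langle>1, u(2n-1) dual u\<rangle>\<close>.  Inverting the invariance relation turns it
  into \<open>(-w^(-2))^n \<Sum>j. Tr (L(-1)^j L(1)^j) / (j!)^2\<close>, the traces being taken over \<open>V n\<close>.
  By cyclicity of the trace and \<open>[L(1), L(-1)] = 2 L(0)\<close> these traces satisfy a recursion whose initial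
  values are the dimensions of the homogeneous spaces.  Solving it and summing over \<open>j\<close> by
  Vandermonde's identity yields \<open>\<Sum>k. ((2n-1 choose n+k-1) - (2n-1 choose n+k)) dim V k\<close>, and by the
  functional equation \<open>f = \<chi> (1 + f)^2\<close> the bracket is the coefficient of \<open>\<chi>^n\<close> in \<open>f^k\<close>.
\<close>

unbundle fps_syntax

subsection \<open>Powers of the Catalan series\<close>

text \<open>With \<open>h = 1 + catalan_series\<close>, squaring the radical recovers
  \<open>h = 1 + fps_X * h ^ 2\<close>. The chosen root has constant term 1, so the division by
  \<open>2 * fps_X\<close> is exact.\<close>

lemma catalan_series_functional_eq:
  "catalan_series = fps_X * (1 + catalan_series)^2"
proof -
  define s :: "complex fps" where "s = fps_radical (\<lambda>_. csqrt) 2 (1 - 4 * fps_X)"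
  have s2: "s ^ 2 = 1 - 4 * fps_X"
    using power_radical[of "1 - 4 * fps_X" "\<lambda>_. csqrt" 1] by (simp add: s_def numeral_2_eq_2)
  define h where "h = 1 + catalan_series"
  have h: "h = (1 - s) / (2 * fps_X)"
    by (simp add: h_def catalan_series_def s_def)
  have "(1 - s) $ 0 = 0" by (simp add: s_def)
  hence "2 * fps_X dvd 1 - s"
    by (cases "1 - s = 0") (auto simp: fps_dvd_iff subdegree_mult intro!: subdegree_geI)
  hence "2 * fps_X * h = 1 - s" by (simp add: h)
  hence "s = 1 - 2 * fps_X * h" by (simp add: algebra_simps)
  with s2 have "(4 * fps_X) * h = (4 * fps_X) * (1 + fps_X * h ^ 2)"
    by (simp add: power2_eq_square algebra_simps)
  hence "h = 1 + fps_X * h ^ 2"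
    by simp
  thus ?thesis by (simp add: h_def)
qed

text \<open>These are ballot numbers. The functional equation for \<open>f\<close> gives
  \<open>f^(k+1) = X (f^k + 2 f^(k+1) + f^(k+2))\<close>, the same recursion as Pascal's rule
  applied twice. Starting at \<open>Suc n\<close> avoids a truncated \<open>2n - 1\<close>.\<close>

lemma catalan_series_power_nth_Suc:
  "(catalan_series ^ k) $ Suc n
     = of_nat ((2 * n + 1) choose (n + k)) - of_nat ((2 * n + 1) choose (n + k + 1))"
proof -
  have f0: "catalan_series $ 0 = 0"
    by (subst catalan_series_functional_eq) simp
  have rec: "(catalan_series ^ Suc k) $ Suc n
      = (catalan_series ^ k) $ n + 2 * (catalan_series ^ Suc k) $ n + (catalan_series ^ Suc (Suc k)) $ n"
    for k n
  proof -
    have "catalan_series ^ Suc k = fps_X * (catalan_series ^ k * (1 + catalan_series)^2)"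
      by (subst power_Suc, subst (1) catalan_series_functional_eq) (simp add: algebra_simps)
    also have "catalan_series ^ k * (1 + catalan_series)^2
        = catalan_series ^ k + fps_const 2 * catalan_series ^ Suc k + catalan_series ^ Suc (Suc k)"
      by (simp add: power2_eq_square algebra_simps flip: numeral_fps_const)
    finally have "(catalan_series ^ Suc k) $ Suc n
        = (fps_X * (catalan_series ^ k + fps_const 2 * catalan_series ^ Suc k + catalan_series ^ Suc (Suc k))) $ Suc n"
      by (rule arg_cong)
    thus ?thesis
      by (simp del: power_Suc)
  qed
  have zero: "(catalan_series ^ k) $ 0 = (if k = 0 then 1 else 0)" for k
    by (simp add: f0)
  show ?thesis
  proof (induction n arbitrary: k)
    case 0
    show ?case
    proof (cases k)
      case (Suc j)
      have "(catalan_series ^ Suc j) $ Suc 0 = (if j = 0 then 1 else 0)"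
        by (subst rec) (simp only: zero, simp)
      thus ?thesis by (simp add: Suc del: power_Suc)
    qed simp
  next
    case (Suc n)
    show ?case
    proof (cases k)
      case 0
      have "(2 * Suc n + 1) choose Suc n = (2 * Suc n + 1) choose (Suc n + 1)"
        by (subst binomial_symmetric) auto
      with 0 show ?thesis by simp
    next
      case k: (Suc j)
      have pascal: "Suc (Suc m) choose Suc (Suc i) = (m choose i) + 2 * (m choose Suc i) + (m choose Suc (Suc i))"
        for m i by simp
      show ?thesis
        using pascal[of "2 * n + 1" "n + j"] pascal[of "2 * n + 1" "n + j + 1"]
        by (simp add: k rec Suc.IH del: power_Suc binomial_Suc_Suc)
    qed
  qed
qed

lemma catalan_series_closed_form:
  "catalan_series = Abs_fps (\<lambda>n. 1 / of_nat n * of_nat ((2 * n) choose (n + 1)))"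
proof (rule fps_ext)
  fix n show "catalan_series $ n = Abs_fps (\<lambda>n. 1 / of_nat n * of_nat ((2 * n) choose (n + 1))) $ n"
  proof (cases n)
    case 0
    \<comment> \<open>At \<open>n = 0\<close> the closed form is 0 too, since
      \<open>0 choose 1 = 0\<close>; the quotient \<open>1 / 0\<close> does no harm.\<close>
    have "catalan_series $ 0 = 0"
      by (subst catalan_series_functional_eq) simp
    with 0 show ?thesis by simp
  next
    case (Suc m)
    define x y where "x = (2 * m + 1) choose (m + 1)" and "y = (2 * m + 1) choose (m + 2)"
    \<comment> \<open>Absorption between neighbours in row 2m + 1; it turns \<open>n (x - y)\<close>
      into \<open>x + y\<close>.\<close>
    have xy: "(m + 2) * y = m * x"
      using binomial_absorption[of "m + 1" "2 * m + 1"] binomial_absorb_comp[of "2 * m + 1" "m + 1"]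
      by (simp add: x_def y_def del: binomial_Suc_Suc)
    have "(of_nat m + 2) * (of_nat y :: complex) = of_nat m * of_nat x"
      using arg_cong[OF xy, of "of_nat :: nat \<Rightarrow> complex"] by (simp add: algebra_simps)
    hence "(of_nat m + 1) * (of_nat x - of_nat y) = (of_nat x + of_nat y :: complex)"
      by (simp add: algebra_simps)
    hence "of_nat n * (of_nat x - of_nat y) = (of_nat (x + y) :: complex)"
      by (simp add: Suc algebra_simps)
    moreover have "of_nat n \<noteq> (0::complex)"
      by (simp add: Suc del: of_nat_Suc)
    ultimately have "of_nat x - of_nat y = 1 / of_nat n * (of_nat (x + y) :: complex)"
      by (simp add: field_simps)
    moreover have "(2 * n) choose (n + 1) = x + y"
      by (simp add: Suc x_def y_def)
    moreover have "catalan_series $ n = of_nat x - of_nat y"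
      using catalan_series_power_nth_Suc[of 1 m] by (simp add: Suc x_def y_def)
    ultimately show ?thesis
      by simp
  qed
qed

section \<open>Solving the recursion of the traces\<close>

text \<open>For \<open>a = n - k\<close> and \<open>b = n + k - 1\<close> this is the step from
  \<open>n\<close> to \<open>n + 1\<close>. The factor depends only on \<open>a + b\<close>, so it
  is \<open>(2n - j) / (j + 1)\<close> for every \<open>k\<close> at once.\<close>

lemma gbinomial_mult_gbinomial_Suc_rec:
  fixes a b :: "'a::field_char_0"
  shows "((a + 1) gchoose Suc j) * ((b + 1) gchoose Suc j)
    = (a gchoose Suc j) * (b gchoose Suc j)
      + (a + b + 1 - of_nat j) / of_nat (Suc j) * ((a gchoose j) * (b gchoose j))"
proof -
  define r :: 'a where "r = of_nat (Suc j)"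
  have r: "r \<noteq> 0" "of_nat j = r - 1" unfolding r_def by (rule of_nat_neq_0) simp
  have Suc_j: "(x gchoose Suc j) = (x - r + 1) / r * (x gchoose j)" for x :: 'a
    using gbinomial_mult_1[of x j] r by (simp add: field_simps flip: r_def del: of_nat_Suc)
  have "1 + (x - r + 1) / r = (x + 1) / r" for x
    using r by (simp add: field_simps)
  hence absorb: "(x + 1) gchoose Suc j = (x + 1) / r * (x gchoose j)" for x :: 'a
    using distrib_right[of 1 "(x - r + 1) / r" "x gchoose j"]
    unfolding gbinomial_Suc_Suc by (simp only: Suc_j mult_1_left)
  have key: "(a + 1) / r * ((b + 1) / r)
      = (a - r + 1) / r * ((b - r + 1) / r) + (a + b + 1 - (r - 1)) / r"
    using r by (simp add: divide_simps) (simp add: algebra_simps)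
  have "((a + 1) gchoose Suc j) * ((b + 1) gchoose Suc j)
      = ((a + 1) / r * ((b + 1) / r)) * ((a gchoose j) * (b gchoose j))"
    by (simp only: absorb mult_ac)
  thus ?thesis
    by (simp only: key distrib_left distrib_right Suc_j[of a] Suc_j[of b] r(2) r_def[symmetric] mult_ac)
qed

text \<open>Abel summation, to trade the differences \<open>q k\<close> below for the initial values
  \<open>t k 0\<close>.\<close>

lemma sum_by_parts:
  fixes d g :: "nat \<Rightarrow> 'a::comm_ring_1"
  shows "(\<Sum>k\<le>n. (d k - (if k = 0 then 0 else d (k - 1))) * g k)
    = (\<Sum>k\<le>n. d k * (g k - g (Suc k))) + d n * g (Suc n)"
  by (induction n) (simp_all add: algebra_simps)

text \<open>
  The hypotheses are the recursion satisfied by \<open>Tr (L(-1)^j L(1)^j)\<close> on \<open>V n\<close>.  Its solution is read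
  off from lowest weight modules: a lowest weight vector of weight \<open>k\<close> contributes
  \<open>(j!)^2 (n - k choose j) (n + k - 1 choose j)\<close>, and there are \<open>q k = dim V k - dim V (k - 1)\<close> of them.
  For \<open>n = k = 0\<close> the second upper index is \<open>-1\<close>, hence the generalised binomials.
\<close>

lemma sum_eq_sum_catalan_power:
  fixes t :: "nat \<Rightarrow> nat \<Rightarrow> complex"
  assumes t_0: "\<And>j. t 0 (Suc j) = 0"
    and t_Suc: "\<And>n j. t (Suc n) (Suc j)
      = t n (Suc j) + of_nat (Suc j) * (2 * of_nat n - of_nat j) * t n j"
  shows "(\<Sum>j\<le>n. t n j / (fact j)^2) = (\<Sum>k\<le>n. t k 0 * (catalan_series ^ k) $ n)"
proof -
  define q where "q k = t k 0 - (if k = 0 then 0 else t (k - 1) 0)" for k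
  have sum_q: "(\<Sum>k\<le>n. q k) = t n 0" for n
    using sum_by_parts[of "\<lambda>k. t k 0" "\<lambda>_. 1" n] by (simp add: q_def)
  define e :: "nat \<Rightarrow> nat \<Rightarrow> nat \<Rightarrow> complex" where
    "e n j k = (of_nat (n - k) gchoose j) * ((of_nat n + of_nat k - 1) gchoose j)" for n j k
  have closed: "t n j / (fact j)^2 = (\<Sum>k\<le>n. q k * e n j k)" for n j
  proof (induction n arbitrary: j)
    case 0
    show ?case
    proof (cases j)
      case 0 thus ?thesis using sum_q[of 0] by (simp add: e_def)
    next
      case (Suc i) thus ?thesis by (simp add: t_0 e_def)
    qed
  next
    case (Suc n)
    show ?case
    proof (cases j)
      case 0 thus ?thesis using sum_q[of "Suc n"] by (simp add: e_def)
    next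
      case j: (Suc i)
      let ?c = "(2 * of_nat n - of_nat i) / of_nat (Suc i) :: complex"
      have "t (Suc n) j / (fact j)^2 = t n (Suc i) / (fact (Suc i))^2 + ?c * (t n i / (fact i)^2)"
        by (simp add: j t_Suc fact_Suc add_divide_distrib power2_eq_square del: of_nat_Suc)
      also have "\<dots> = (\<Sum>k\<le>n. q k * (e n (Suc i) k + ?c * e n i k))"
        by (simp only: Suc.IH sum_distrib_left sum.distrib distrib_left mult.left_commute)
      also have "\<dots> = (\<Sum>k\<le>n. q k * e (Suc n) j k)"
      proof (rule sum.cong[OF refl])
        fix k assume "k \<in> {..n}"
        hence "k \<le> n" by simp
        thus "q k * (e n (Suc i) k + ?c * e n i k) = q k * e (Suc n) j k"
          using gbinomial_mult_gbinomial_Suc_rec[of "of_nat (n - k) :: complex" i "of_nat n + of_nat k - 1"]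
          by (simp add: e_def j Suc_diff_le of_nat_diff add_ac)
      qed
      \<comment> \<open>The new term \<open>k = Suc n\<close> vanishes through its factor
        \<open>0 gchoose Suc i\<close>.\<close>
      also have "\<dots> = (\<Sum>k\<le>Suc n. q k * e (Suc n) j k)"
        by (simp add: e_def j)
      finally show ?thesis .
    qed
  qed
  have vandermonde: "(\<Sum>j\<le>n. e n j k) = ((2 * of_nat n - 1) gchoose (n - k))" if "k \<le> n" for k
  proof -
    have "(\<Sum>j\<le>n. e n j k) = (\<Sum>j\<in>{0..n - k}. e n j k)"
      by (rule sum.mono_neutral_right) (auto simp: e_def simp flip: binomial_gbinomial)
    also have "\<dots> = (\<Sum>j\<in>{0..n - k}. ((of_nat n + of_nat k - 1) gchoose j) * (of_nat (n - k) gchoose (n - k - j)))"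
    proof (rule sum.cong[OF refl])
      fix j assume "j \<in> {0..n - k}"
      hence "(n - k) choose j = (n - k) choose (n - k - j)"
        by (intro binomial_symmetric) simp
      thus "e n j k = ((of_nat n + of_nat k - 1) gchoose j) * (of_nat (n - k) gchoose (n - k - j))"
        by (simp only: e_def mult.commute flip: binomial_gbinomial)
    qed
    also have "\<dots> = ((2 * of_nat n - 1) gchoose (n - k))"
      by (subst gbinomial_Vandermonde) (simp add: that of_nat_diff)
    finally show ?thesis .
  qed
  have "(\<Sum>j\<le>n. t n j / (fact j)^2) = (\<Sum>j\<le>n. \<Sum>k\<le>n. q k * e n j k)"
    by (simp only: closed)
  also have "\<dots> = (\<Sum>k\<le>n. \<Sum>j\<le>n. q k * e n j k)"
    by (rule sum.swap)
  also have "\<dots> = (\<Sum>k\<le>n. q k * ((2 * of_nat n - 1) gchoose (n - k)))"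
    by (intro sum.cong refl) (simp only: vandermonde atMost_iff flip: sum_distrib_left)
  also have "\<dots> = (\<Sum>k\<le>n. t k 0 * (catalan_series ^ k) $ n)"
  proof (cases n)
    case 0 thus ?thesis using sum_q[of 0] by simp
  next
    case (Suc m)
    define g :: "nat \<Rightarrow> complex" where "g k = of_nat ((2 * m + 1) choose (m + k))" for k
    have "(\<Sum>k\<le>n. q k * ((2 * of_nat n - 1) gchoose (n - k))) = (\<Sum>k\<le>n. q k * g k)"
    proof (rule sum.cong[OF refl])
      fix k assume "k \<in> {..n}"
      hence "k \<le> Suc m" by (simp add: Suc)
      hence "(2 * m + 1) choose (m + k) = (2 * m + 1) choose (n - k)"
        by (subst binomial_symmetric) (auto simp: Suc intro!: arg_cong[where f = "binomial _"])
      moreover have "2 * of_nat n - 1 = (of_nat (2 * m + 1) :: complex)"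
        by (simp add: Suc)
      ultimately show "q k * ((2 * of_nat n - 1) gchoose (n - k)) = q k * g k"
        by (simp only: g_def binomial_gbinomial)
    qed
    also have "\<dots> = (\<Sum>k\<le>n. t k 0 * (g k - g (Suc k))) + t n 0 * g (Suc n)"
      unfolding q_def by (rule sum_by_parts)
    \<comment> \<open>The lower index is 2m + 2, beyond row 2m + 1.\<close>
    also have "g (Suc n) = 0"
      unfolding g_def Suc by (subst binomial_eq_0) auto
    finally show ?thesis
      by (simp add: Suc catalan_series_power_nth_Suc g_def del: binomial_Suc_Suc)
  qed
  finally show ?thesis .
qed

subsection \<open>The action of \<open>sl(2)\<close> on a vertex operator algebra\<close>

context vertex_operator_algebra
begin

abbreviation L :: "int \<Rightarrow> 'v \<Rightarrow> 'v" where
  "L \<equiv> virasoro_mode Y \<omega>"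

text \<open>
  Type inference over the whole locale declaration makes the index \<open>n\<close> of its axioms a natural
  number (because of \<open>V n\<close>), and likewise the \<open>k\<close> of \<open>borcherds\<close>.  Hence linearity, translation
  and the commutator formula are directly available for nonnegative modes only; negative modes are
  controlled further below through invariance and nondegeneracy.
\<close>

lemma mode_hom: "n \<ge> 0 \<Longrightarrow> module_hom scale scale (Y u n)"
  using mode_linear[of u "nat n"] by (simp only: module_hom_iff_linear int_nat_eq if_True)

lemma state_hom: "n \<ge> 0 \<Longrightarrow> module_hom scale scale (\<lambda>u. Y u n v)"
  using state_linear[of "nat n" v] by (simp only: module_hom_iff_linear int_nat_eq if_True)

lemma virasoro_mode_hom: "n \<ge> -1 \<Longrightarrow> module_hom scale scale (L n)"
  using mode_hom[of "n + 1" \<omega>] by (simp add: virasoro_mode_def)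

lemma virasoro_mode_power_hom: "n \<ge> -1 \<Longrightarrow> module_hom scale scale (L n ^^ j)"
proof (induction j)
  case 0 show ?case by unfold_locales auto
next
  case (Suc j) show ?case
    using module_hom_compose[OF Suc.IH[OF Suc.prems] virasoro_mode_hom[OF Suc.prems]]
    by (simp add: o_def)
qed

lemma mode_of_zero_nonneg: "n \<ge> 0 \<Longrightarrow> Y 0 n v = 0"
  using module_hom.zero[OF state_hom] .

lemma zero_in_grade: "0 \<in> V n"
  using grade_subspace subspace_0 by blast

text \<open>The components of \<open>(L(0) - \<mu>) x = 0\<close> are
  \<open>(n - \<mu>) f n\<close>, and uniqueness of the decomposition makes each vanish. This is how
  the effect of \<open>L(1)\<close> and \<open>L(-1)\<close> on the grading is derived.\<close>

lemma L0_eigenvector_cases: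
  assumes "L 0 x = scale \<mu> x"
  obtains "x = 0" | k where "\<mu> = of_nat k" "x \<in> V k"
proof -
  obtain f where f: "\<And>n. f n \<in> V n" "finite {n. f n \<noteq> 0}" "x = (\<Sum>n | f n \<noteq> 0. f n)"
    using grade_decomposition[of x] by auto
  define g where "g n = scale (of_nat n - \<mu>) (f n)" for n
  have g: "g n \<in> V n" for n
    unfolding g_def using f(1) grade_subspace subspace_scale by blast
  have support: "{n. g n \<noteq> 0} \<subseteq> {n. f n \<noteq> 0}"
    by (auto simp: g_def)
  have "L 0 x = (\<Sum>n | f n \<noteq> 0. scale (of_nat n) (f n))"
    by (subst f(3)) (simp add: module_hom.sum[OF virasoro_mode_hom] L0_grading[OF f(1)])
  moreover have "scale \<mu> x = (\<Sum>n | f n \<noteq> 0. scale \<mu> (f n))"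
    by (subst f(3)) (rule scale_sum_right)
  ultimately have "(\<Sum>n | f n \<noteq> 0. g n) = 0"
    using assms by (simp add: g_def scale_left_diff_distrib sum_subtractf)
  hence "0 = (\<Sum>n | g n \<noteq> 0. g n)"
    using sum.mono_neutral_left[OF f(2) support, of g] by simp
  hence "g = (\<lambda>_. 0)"
    using grade_decomposition[of 0] g finite_subset[OF support f(2)] zero_in_grade
    by (metis (mono_tags, lifting) Collect_empty_eq finite.emptyI sum.empty)
  hence weight: "f n \<noteq> 0 \<Longrightarrow> \<mu> = of_nat n" for n
    using scale_eq_0_iff by (metis g_def eq_iff_diff_eq_0)
  show thesis
  proof (cases "x = 0")
    case False
    then obtain k where k: "f k \<noteq> 0"
      using f(3) by (metis (mono_tags, lifting) mem_Collect_eq sum.neutral)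
    hence "{n. f n \<noteq> 0} = {k}"
      using weight by (auto dest: of_nat_eq_iff[THEN iffD1])
    hence "x = f k"
      using f(3) by simp
    with weight[OF k] f(1)[of k] that(2) show thesis by blast
  qed (rule that(1))
qed

lemma L0_virasoro_mode:
  assumes "u \<in> V n" "m \<ge> -1"
  shows "L 0 (L m u) = scale (of_nat n - of_int m) (L m u)"
  using virasoro[of m 0 u] L0_grading[OF assms(1)]
  by (cases "m = 0")
    (simp_all add: module_hom.scale[OF virasoro_mode_hom] assms(2) scale_left_diff_distrib algebra_simps)

lemma raise_grade: "u \<in> V n \<Longrightarrow> L (-1) u \<in> V (Suc n)"
  by (rule L0_eigenvector_cases[OF L0_virasoro_mode[of u n "-1"]])
    (auto simp: zero_in_grade add.commute simp flip: of_nat_Suc simp del: of_nat_Suc)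

lemma lower_grade: "u \<in> V (Suc n) \<Longrightarrow> L 1 u \<in> V n"
  by (rule L0_eigenvector_cases[OF L0_virasoro_mode[of u "Suc n" 1]]) (auto simp: zero_in_grade)

lemma lower_grade_0:
  assumes "u \<in> V 0"
  shows "L 1 u = 0"
proof (rule L0_eigenvector_cases[OF L0_virasoro_mode[OF assms, of 1]])
  fix k assume "of_nat 0 - of_int 1 = (of_nat k :: complex)"
  hence "of_nat (Suc k) = (0 :: complex)"
    using add_eq_0_iff[of "1 :: complex" "of_nat k"] by simp
  thus "L 1 u = 0" by (simp only: of_nat_neq_0)
qed simp_all

lemma raise_power_grade: "u \<in> V n \<Longrightarrow> (L (-1) ^^ j) u \<in> V (n + j)"
  by (induction j) (auto dest: raise_grade)

lemma lower_power_grade: "u \<in> V n \<Longrightarrow> j \<le> n \<Longrightarrow> (L 1 ^^ j) u \<in> V (n - j)"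
proof (induction j)
  case (Suc j)
  hence "(L 1 ^^ j) u \<in> V (Suc (n - Suc j))"
    by (simp add: Suc_diff_Suc)
  thus ?case using lower_grade by simp
qed simp

lemma lower_power_eq_0:
  assumes "u \<in> V n" "n < j"
  shows "(L 1 ^^ j) u = 0"
proof -
  obtain i where j: "j = i + Suc n" using assms(2) less_iff_Suc_add[of n j] by auto
  have "(L 1 ^^ Suc n) u = 0"
    using lower_power_grade[OF assms(1) order_refl] by (simp add: lower_grade_0)
  thus ?thesis
    unfolding j funpow_add by (simp add: module_hom.zero[OF virasoro_mode_power_hom] del: funpow.simps)
qed

text \<open>Passing each of the \<open>j + 1\<close> factors \<open>L(-1)\<close> leaves
  \<open>2 L(0)\<close>, on weights m, ..., m + j in turn; twice these weights sum to
  \<open>(j + 1) (2m + j)\<close>.\<close>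

lemma lower_raise_power:
  assumes "v \<in> V m"
  shows "L 1 ((L (-1) ^^ Suc j) v) = (L (-1) ^^ Suc j) (L 1 v)
    + scale (of_nat (Suc j) * (2 * of_nat m + of_nat j)) ((L (-1) ^^ j) v)"
proof -
  have comm: "L 1 (L (-1) x) = L (-1) (L 1 x) + scale (2 * of_nat n) x" if "x \<in> V n" for x n
    using virasoro[of "-1" 1 x] L0_grading[OF that] by (simp add: algebra_simps)
  show ?thesis
  proof (induction j)
    case 0 show ?case using comm[OF assms] by simp
  next
    case (Suc j)
    let ?x = "(L (-1) ^^ Suc j) v"
    have "L 1 ((L (-1) ^^ Suc (Suc j)) v) = L (-1) (L 1 ?x) + scale (2 * of_nat (m + Suc j)) ?x"
      using comm[OF raise_power_grade[OF assms, of "Suc j"]] by simp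
    also have "L (-1) (L 1 ?x) = (L (-1) ^^ Suc (Suc j)) (L 1 v)
        + scale (of_nat (Suc j) * (2 * of_nat m + of_nat j)) ?x"
      unfolding Suc.IH by (simp add: module_hom.add[OF virasoro_mode_hom] module_hom.scale[OF virasoro_mode_hom])
    finally show ?case
      by (simp add: algebra_simps flip: scale_left_distrib del: funpow.simps)
  qed
qed

text \<open>The case \<open>n = 0\<close> of \<open>borcherds\<close>: \<open>0 gchoose j\<close>
  leaves only \<open>j = 0\<close> on one side, and \<open>N choose j\<close> cuts off the other at
  \<open>N\<close>.\<close>

lemma mode_commutator:
  assumes "m \<ge> 0"
  shows "Y a (int N) (Y b m v) - Y b m (Y a (int N) v)
    = (\<Sum>j\<le>N. scale (of_nat (N choose j)) (Y (Y a (int j) b) (int N + m - int j) v))"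
proof -
  have choose: "of_int (int N) gchoose j = (of_nat (N choose j) :: complex)" for j
    by (simp add: binomial_gbinomial)
  have "(\<Sum>j\<le>N. scale (of_nat (N choose j)) (Y (Y a (int j) b) (int N + m - int j) v))
      = Sum_any (\<lambda>j::nat. scale (of_int (int N) gchoose j) (Y (Y a (int 0 + int j) b) (int N + m - int j) v))"
    unfolding choose by (subst Sum_any.expand_superset[of "{..N}"]) (auto simp: not_le)
  also have "\<dots> = Sum_any (\<lambda>j::nat. scale ((-1) ^ j * (of_int (int 0) gchoose j))
           (Y a (int N + int 0 - int j) (Y b (m + int j) v)
            - scale ((-1) powi int 0) (Y b (int 0 + m - int j) (Y a (int N + int j) v))))"
    using borcherds[of "int N" a 0 b "nat m" v] assms by (simp only: int_nat_eq if_True)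
  also have "\<dots> = (\<Sum>j\<in>{0}. scale ((-1) ^ j * (of_int (int 0) gchoose j))
           (Y a (int N + int 0 - int j) (Y b (m + int j) v)
            - scale ((-1) powi int 0) (Y b (int 0 + m - int j) (Y a (int N + int j) v))))"
    by (rule Sum_any.expand_superset) (auto simp: gbinomial_0_left)
  finally show ?thesis by simp
qed

lemma mode_translation: "n \<ge> 0 \<Longrightarrow> Y (L (-1) u) n v = scale (- of_int n) (Y u (n - 1) v)"
  using translation[of u "nat n" v] by simp

lemma L0_mode_commutator:
  assumes "b \<in> V k" "m \<ge> 0"
  shows "L 0 (Y b m v) = Y b m (L 0 v) + scale (of_nat k - of_int m - 1) (Y b m v)"
  using mode_commutator[OF assms(2), of \<omega> 1 b v] mode_translation[of "1 + m" b v] assms(2)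
    L0_grading[OF assms(1)]
  by (simp add: virasoro_mode_def module_hom.scale[OF state_hom] algebra_simps)

text \<open>As \<open>L(1) = \<omega>(2)\<close>, the states \<open>L(-1) b\<close>,
  \<open>L(0) b\<close>, \<open>L(1) b\<close> enter with coefficients 1, 2, 1; translation turns
  the first into \<open>-(m + 2) b(m + 1)\<close>.\<close>

lemma L1_mode_commutator:
  assumes "b \<in> V k" "m \<ge> 0"
  shows "L 1 (Y b m v)
    = Y b m (L 1 v) + scale (2 * of_nat k - of_int m - 2) (Y b (m + 1) v) + Y (L 1 b) m v"
  using mode_commutator[OF assms(2), of \<omega> 2 b v] mode_translation[of "2 + m" b v] assms(2)
    L0_grading[OF assms(1)]
  by (simp add: virasoro_mode_def module_hom.scale[OF state_hom] eval_nat_numeral algebra_simps)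

lemma virasoro_mode_vacuum: "n \<ge> -1 \<Longrightarrow> L n vac = 0"
  using creation_regular[of "nat (n + 1)" \<omega>] by (simp add: virasoro_mode_def)

end

subsection \<open>The invariant form\<close>

context li_zamolodchikov_metric
begin

lemma form_left_hom: "module_hom scale (*) (\<lambda>u. form u v)"
  unfolding module_hom_iff_linear by (rule form_linear_left)

lemma form_right_hom: "module_hom scale (*) (form u)"
  unfolding module_hom_iff_linear by (rule form_linear_right)

end

locale nondegenerate_li_zamolodchikov_metric = li_zamolodchikov_metric scale V Y vac \<omega> c form
  for scale :: "complex \<Rightarrow> 'v::ab_group_add \<Rightarrow> 'v" and V Y vac \<omega> c form +
  assumes nondegenerate: "nondegenerate form"
    and vacuum_span: "V 0 = span {vac}"
begin

lemma form_eqI: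
  assumes "\<And>x. form y x = form z x"
  shows "y = z"
proof -
  have "form (y - z) x = 0" for x
    using assms by (simp add: module_hom.diff[OF form_left_hom])
  hence "y - z = 0"
    using nondegenerate unfolding nondegenerate_def by blast
  thus ?thesis by simp
qed

text \<open>
  The zero state is homogeneous of every weight \<open>k\<close>, and the right-hand side of \<open>invariant\<close> depends
  on \<open>p\<close> and \<open>k\<close> only through \<open>p + 2k\<close> and a sign.  So \<open>p\<close> can be moved to where the left-hand side
  is a nonnegative mode.
\<close>

lemma mode_of_zero: "Y 0 n v = 0"
proof (rule form_eqI)
  fix x
  define S where "S N = Sum_any (\<lambda>j::nat. scale (1 / fact j) (Y 0 (N - int j) x))" for N
  have "(L 1 ^^ j) 0 = 0" for j
    by (rule module_hom.zero[OF virasoro_mode_power_hom]) simp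
  hence adjoint: "form (Y 0 (- p - 1) v) x = (-1) ^ k * form v (S (p + 2 * int k - 1))" for p k
    using invariant[OF zero_in_grade, of p v x k]
    by (simp add: adjoint_coeff_def S_def module_hom.scale[OF form_right_hom] algebra_simps)
  define k where "k = nat (- n)"
  have "form (Y 0 (- (- n - 1 - 2 * int k) - 1) v) x = 0"
    by (subst mode_of_zero_nonneg) (auto simp: k_def module_hom.zero[OF form_left_hom])
  hence "form v (S (- n - 1 + 2 * int 0 - 1)) = 0"
    unfolding adjoint[of _ k] by simp
  hence "form (Y 0 (- (- n - 1) - 1) v) x = 0"
    unfolding adjoint[of _ 0] by simp
  thus "form (Y 0 n v) x = form 0 x"
    by (simp add: module_hom.zero[OF form_left_hom])
qed

lemma mode_zero: "a \<in> V k \<Longrightarrow> Y a n 0 = 0"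
  using invariant[of a k "- n - 1" 0]
  by (intro form_eqI) (simp add: module_hom.zero[OF form_left_hom])

text \<open>\<omega> is quasi-primary: \<open>[L(-2), L(1)]\<close> is a multiple of
  \<open>L(-1)\<close>, both \<open>L(1)\<close> and \<open>L(-1)\<close> kill \<open>vac\<close>,
  and \<open>L(-2) vac = \<omega>\<close>.\<close>

lemma lower_conformal_vector: "L 1 \<omega> = 0"
proof -
  have "L (-2) vac = \<omega>" "L (-2) 0 = 0"
    using creation[of \<omega>] mode_zero[OF conformal_grade] by (simp_all add: virasoro_mode_def)
  thus ?thesis
    using virasoro[of "-2" 1 vac] by (simp add: virasoro_mode_vacuum)
qed

lemma adjoint_coeff_grade:
  assumes "a \<in> V k"
  shows "adjoint_coeff scale Y \<omega> k a p v = scale ((-1) ^ k)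
    (\<Sum>j\<le>k. scale (1 / fact j) (Y ((L 1 ^^ j) a) (p - int j + 2 * int k - 1) v))"
proof -
  have "Y ((L 1 ^^ j) a) m v = 0" if "\<not> j \<le> k" for j m
    using lower_power_eq_0[OF assms, of j] that by (simp add: mode_of_zero)
  hence "{j. scale (1 / fact j) (Y ((L 1 ^^ j) a) (p - int j + 2 * int k - 1) v) \<noteq> 0} \<subseteq> {..k}"
    by - (rule subsetI, rule ccontr, simp)
  thus ?thesis
    unfolding adjoint_coeff_def by (simp only: Sum_any.expand_superset[OF finite_atMost])
qed

text \<open>As \<omega> is quasi-primary of weight 2, only \<open>j = 0\<close> survives in its
  adjoint, with sign +1.\<close>

lemma form_virasoro_mode: "form (L n u) v = form u (L (- n) v)"
proof -
  have "form (L n u) v = form u (adjoint_coeff scale Y \<omega> 2 \<omega> (- n - 2) v)"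
    using invariant[OF conformal_grade, of "- n - 2" u v]
    by (simp add: virasoro_mode_def add.commute)
  also have "adjoint_coeff scale Y \<omega> 2 \<omega> (- n - 2) v = L (- n) v"
    unfolding adjoint_coeff_grade[OF conformal_grade]
    by (simp add: numeral_2_eq_2 lower_conformal_vector virasoro_mode_hom[THEN module_hom.zero]
        mode_of_zero) (simp add: virasoro_mode_def)
  finally show ?thesis .
qed

lemma form_vac_virasoro_mode: "n \<le> 1 \<Longrightarrow> form vac (L n v) = 0"
  using form_virasoro_mode[of "- n" vac v]
  by (simp add: virasoro_mode_vacuum module_hom.zero[OF form_left_hom])

text \<open>
  For a negative mode the commutator with \<open>L(0)\<close> is computed on the adjoint side, where only
  nonnegative modes occur.  The excluded case is the mode \<open>-1\<close> of a state of weight 0.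
\<close>

lemma L0_mode:
  assumes "a \<in> V k" "v \<in> V n" "m \<ge> 0 \<or> k \<noteq> 0 \<or> m \<noteq> -1"
  shows "L 0 (Y a m v) = scale (of_nat k + of_nat n - of_int m - 1) (Y a m v)"
proof (cases "m \<ge> 0")
  case True
  thus ?thesis
    using L0_mode_commutator[OF assms(1) True, of v]
    by (simp add: L0_grading[OF assms(2)] module_hom.scale[OF mode_hom] algebra_simps)
next
  case False
  show ?thesis
  proof (rule form_eqI)
    fix x
    define adj where "adj = adjoint_coeff scale Y \<omega> k a (- m - 1)"
    define b where "b j = scale (1 / fact j) (Y ((L 1 ^^ j) a) (2 * int k - m - int j - 2) x)" for j
    have adj: "adj y = scale ((-1) ^ k)
        (\<Sum>j\<le>k. scale (1 / fact j) (Y ((L 1 ^^ j) a) (2 * int k - m - int j - 2) y))" for y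
      unfolding adj_def adjoint_coeff_grade[OF assms(1)] by (simp add: algebra_simps)
    hence adj_x: "adj x = scale ((-1) ^ k) (\<Sum>j\<le>k. b j)"
      unfolding b_def .
    have b_L0: "scale (1 / fact j) (Y ((L 1 ^^ j) a) (2 * int k - m - int j - 2) (L 0 x))
        = L 0 (b j) + scale (of_nat k - of_int m - 1) (b j)" if "j \<le> k" for j
    proof -
      \<comment> \<open>The smallest index, at \<open>j = k\<close>, is \<open>k - m - 2\<close>;
        for \<open>m < 0\<close> it is negative only in the excluded case.\<close>
      have "2 * int k - m - int j - 2 \<ge> 0"
        using that assms(3) False by linarith
      note comm = L0_mode_commutator[OF lower_power_grade[OF assms(1) that] this, of x]
      \<comment> \<open>Weight and mode index both drop by \<open>j\<close>, so the shift is the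
        same for every \<open>j\<close>.\<close>
      have "of_nat (k - j) - of_int (2 * int k - m - int j - 2) - 1
          = (- (of_nat k - of_int m - 1) :: complex)"
        using that by (simp add: of_nat_diff)
      hence "Y ((L 1 ^^ j) a) (2 * int k - m - int j - 2) (L 0 x)
          = L 0 (Y ((L 1 ^^ j) a) (2 * int k - m - int j - 2) x)
            + scale (of_nat k - of_int m - 1) (Y ((L 1 ^^ j) a) (2 * int k - m - int j - 2) x)"
        by (simp only: comm scale_minus_left) simp
      thus ?thesis
        by (simp add: b_def module_hom.scale[OF virasoro_mode_hom] scale_right_distrib mult.commute)
    qed
    have "adj (L 0 x)
        = scale ((-1) ^ k) (\<Sum>j\<le>k. L 0 (b j) + scale (of_nat k - of_int m - 1) (b j))"
      unfolding adj by (intro arg_cong[where f = "scale _"] sum.cong refl b_L0) (simp only: atMost_iff)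
    also have "\<dots> = L 0 (adj x) + scale (of_nat k - of_int m - 1) (adj x)"
      unfolding adj_x by (simp add: sum.distrib scale_sum_right module_hom.scale[OF virasoro_mode_hom]
          module_hom.sum[OF virasoro_mode_hom] scale_right_distrib mult.commute)
    finally have adj_L0: "adj (L 0 x) = L 0 (adj x) + scale (of_nat k - of_int m - 1) (adj x)" .
    have invariant: "form (Y a m v) y = form v (adj y)" for y
      using invariant[OF assms(1), of "- m - 1" v y] by (simp add: adj_def)
    have "form (L 0 (Y a m v)) x = form v (adj (L 0 x))"
      by (simp add: form_virasoro_mode invariant)
    also have "\<dots> = form (L 0 v) (adj x) + (of_nat k - of_int m - 1) * form v (adj x)"
      by (simp add: adj_L0 form_virasoro_mode module_hom.add[OF form_right_hom]
          module_hom.scale[OF form_right_hom])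
    also have "\<dots> = (of_nat k + of_nat n - of_int m - 1) * form (Y a m v) x"
      by (simp add: L0_grading[OF assms(2)] invariant module_hom.scale[OF form_left_hom] algebra_simps)
    finally show "form (L 0 (Y a m v)) x
        = form (scale (of_nat k + of_nat n - of_int m - 1) (Y a m v)) x"
      by (simp add: module_hom.scale[OF form_left_hom])
  qed
qed

text \<open>\<open>vac\<close> is orthogonal to the image of \<open>L(0)\<close>, which contains
  every eigenvector with nonzero eigenvalue.\<close>

lemma form_vac_mode_eq_0:
  assumes "a \<in> V k" "v \<in> V n" "m \<ge> 0 \<or> k \<noteq> 0 \<or> m \<noteq> -1" "m + 1 \<noteq> int (k + n)"
  shows "form vac (Y a m v) = 0"
proof -
  have "of_nat k + of_nat n - of_int m - 1 = (of_int (int (k + n) - (m + 1)) :: complex)"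
    by simp
  also have "\<dots> \<noteq> 0"
    using assms(4) by (simp only: of_int_eq_0_iff)
  finally show ?thesis
    using form_vac_virasoro_mode[of 0 "Y a m v"] unfolding L0_mode[OF assms(1-3)]
    by (simp add: module_hom.scale[OF form_right_hom])
qed

section \<open>Inverting the invariance relation\<close>

text \<open>\<open>vac\<close> is orthogonal to the image of \<open>L(1)\<close>, because
  \<open>L(-1) vac = 0\<close>; the rest is the commutator.\<close>

lemma form_vac_mode_lower:
  assumes "b \<in> V k" "m \<ge> 0"
  shows "form vac (Y b m (L 1 v))
    = (of_int m + 2 - 2 * of_nat k) * form vac (Y b (m + 1) v) - form vac (Y (L 1 b) m v)"
proof -
  have "0 = form vac (L 1 (Y b m v))"
    by (simp add: form_vac_virasoro_mode)
  also have "\<dots> = form vac (Y b m (L 1 v)) + (2 * of_nat k - of_int m - 2) * form vac (Y b (m + 1) v)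
      + form vac (Y (L 1 b) m v)"
    by (simp only: L1_mode_commutator[OF assms] module_hom.add[OF form_right_hom]
        module_hom.scale[OF form_right_hom])
  finally show ?thesis
    by (simp add: algebra_simps)
qed

lemma form_raise_power_0:
  assumes "a \<in> V k"
  shows "form a v = (-1) ^ k * (\<Sum>j\<le>k. form vac (Y ((L 1 ^^ j) a) (2 * int k - int j - 1) v) / fact j)"
  using invariant[OF assms, of 0 vac v]
  by (simp add: creation adjoint_coeff_grade[OF assms] module_hom.scale[OF form_right_hom]
      module_hom.sum[OF form_right_hom])

text \<open>
  Formally this is \<open>invariant\<close> for the mode \<open>a(-i-1) vac = L(-1)^i a / i!\<close>.  As that formula is not
  available for negative modes, one power of \<open>L(-1)\<close> at a time is moved across the form instead.
\<close>

lemma form_raise_power: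
  assumes "a \<in> V k" "v \<in> V (k + i)"
  shows "form ((L (-1) ^^ i) a) v / fact i
    = (-1) ^ k * (\<Sum>j\<le>k. form vac (Y ((L 1 ^^ j) a) (int i + 2 * int k - int j - 1) v) / fact j)"
  using assms(2)
proof (induction i arbitrary: v)
  case 0 show ?case using form_raise_power_0[OF assms(1), of v] by simp
next
  case (Suc i)
  show ?case
  proof (cases "k = 0")
    \<comment> \<open>Weight 0 is set apart, since at \<open>i = 0\<close> the mode to be commuted
      with \<open>L(1)\<close> would be -1. Here \<open>a\<close> is a multiple of
      \<open>vac\<close> and both sides vanish.\<close>
    case True
    then obtain r where a: "a = scale r vac"
      using assms(1) vacuum_span by (auto simp: span_singleton)
    have "Y vac (int i) v = 0"
      using vacuum_identity[of i v] by simp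
    hence "Y a (int i) v = 0"
      by (simp add: a module_hom.scale[OF state_hom])
    moreover have "(L (-1) ^^ Suc i) a = 0"
      unfolding funpow_Suc_right o_def a
      by (simp add: module_hom.scale[OF virasoro_mode_hom] virasoro_mode_vacuum
          module_hom.zero[OF virasoro_mode_power_hom])
    ultimately show ?thesis
      using True by (simp add: module_hom.zero[OF form_left_hom] module_hom.zero[OF form_right_hom]
          del: funpow.simps)
  next
    case False
    define P where "P j = form vac (Y ((L 1 ^^ j) a) (int (Suc i) + 2 * int k - int j - 1) v)" for j
    have step: "form vac (Y ((L 1 ^^ j) a) (int i + 2 * int k - int j - 1) (L 1 v))
        = (of_nat (Suc i) + of_nat j) * P j - P (Suc j)" if "j \<le> k" for j
    proof -
      have "int i + 2 * int k - int j - 1 \<ge> 0"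
        using that False by linarith
      from form_vac_mode_lower[OF lower_power_grade[OF assms(1) that] this, of v] that
      show ?thesis
        by (simp add: P_def of_nat_diff algebra_simps)
    qed
    have P_end: "P (Suc k) = 0"
      using lower_power_eq_0[OF assms(1), of "Suc k"]
      by (simp add: P_def mode_of_zero module_hom.zero[OF form_right_hom] del: funpow.simps)
    \<comment> \<open>Only \<open>- P (Suc k) / fact k\<close> is left over, and
      \<open>L(1)^(k+1)\<close> kills \<open>a\<close>.\<close>
    have telescope: "(\<Sum>j\<le>k. (of_nat j * P j - P (Suc j)) / fact j) = 0"
    proof -
      have "(\<Sum>j\<le>N. (of_nat j * P j - P (Suc j)) / fact j) = - P (Suc N) / fact N" for N
      proof (induction N)
        case (Suc N)
        have "(of_nat (Suc N) * x - y) / fact (Suc N) = x / fact N - y / fact (Suc N)" for x y :: complex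
          by (simp add: fact_Suc diff_divide_distrib del: of_nat_Suc)
        with Suc show ?case by simp
      qed simp
      thus ?thesis by (simp add: P_end)
    qed
    have "form ((L (-1) ^^ Suc i) a) v / fact i = form ((L (-1) ^^ i) a) (L 1 v) / fact i"
      by (simp add: form_virasoro_mode)
    also have "\<dots> = (-1) ^ k * (\<Sum>j\<le>k. ((of_nat (Suc i) + of_nat j) * P j - P (Suc j)) / fact j)"
      using Suc.prems lower_grade[of v "k + i"] by (simp add: Suc.IH step del: of_nat_Suc)
    also have "(\<Sum>j\<le>k. ((of_nat (Suc i) + of_nat j) * P j - P (Suc j)) / fact j)
        = of_nat (Suc i) * (\<Sum>j\<le>k. P j / fact j) + (\<Sum>j\<le>k. (of_nat j * P j - P (Suc j)) / fact j)"
      unfolding sum_distrib_left sum.distrib[symmetric]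
      by (rule sum.cong) (simp_all add: add_divide_distrib diff_divide_distrib distrib_right del: of_nat_Suc)
    finally have "form ((L (-1) ^^ Suc i) a) v / fact i
        = of_nat (Suc i) * ((-1) ^ k * (\<Sum>j\<le>k. P j / fact j))"
      by (simp add: telescope mult_ac)
    thus ?thesis
      unfolding P_def by (simp add: fact_Suc field_simps del: of_nat_Suc funpow.simps)
  qed
qed

text \<open>
  The inverse of the previous relation: the coefficients \<open>(-1)^i/i!\<close> of \<open>e^(-z)\<close> undo those of \<open>e^z\<close>.
\<close>

lemma form_vac_mode_eq_sum:
  assumes "b \<in> V n" "v \<in> V n"
  shows "(-1) ^ n * form vac (Y b (2 * int n - 1) v)
    = (\<Sum>i\<le>n. form ((L (-1) ^^ i) ((L 1 ^^ i) b)) v / (fact i)^2)"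
proof -
  define P where "P l = form vac (Y ((L 1 ^^ l) b) (2 * int n - int l - 1) v)" for l
  define g :: "nat \<Rightarrow> nat \<Rightarrow> complex" where
    "g i j = (-1) ^ (n + i) / (fact i * fact j) * P (i + j)" for i j
  have "form ((L (-1) ^^ i) ((L 1 ^^ i) b)) v / (fact i)^2 = (\<Sum>j\<le>n - i. g i j)" if "i \<le> n" for i
  proof -
    have sign: "(-1) ^ (n - i) = ((-1) ^ (n + i) :: complex)"
      using that by (simp add: minus_one_power_iff)
    have power: "(L 1 ^^ j) ((L 1 ^^ i) b) = (L 1 ^^ (i + j)) b" for j
      by (simp add: funpow_add flip: add.commute[of j i])
    have index: "int i + 2 * int (n - i) - int j - 1 = 2 * int n - int (i + j) - 1" for j
      using that by simp
    have "form ((L (-1) ^^ i) ((L 1 ^^ i) b)) v / fact i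
        = (-1) ^ (n + i) * (\<Sum>j\<le>n - i. P (i + j) / fact j)"
      using form_raise_power[OF lower_power_grade[OF assms(1) that], of v i] that assms(2)
      unfolding power index sign P_def by simp
    hence "form ((L (-1) ^^ i) ((L 1 ^^ i) b)) v / fact i / fact i
        = (-1) ^ (n + i) * (\<Sum>j\<le>n - i. P (i + j) / fact j) / fact i"
      by (rule arg_cong)
    thus ?thesis
      by (simp add: g_def power2_eq_square sum_distrib_left sum_divide_distrib mult.commute)
  qed
  hence "(\<Sum>i\<le>n. form ((L (-1) ^^ i) ((L 1 ^^ i) b)) v / (fact i)^2) = (\<Sum>i\<le>n. \<Sum>j\<le>n - i. g i j)"
    by simp
  also have "\<dots> = (\<Sum>(i, j)\<in>{(i, j). i + j \<le> n}. g i j)"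
    by (subst sum.Sigma) (auto intro!: sum.cong)
  also have "\<dots> = (\<Sum>l\<le>n. \<Sum>i\<le>l. g i (l - i))"
    by (rule sum.triangle_reindex_eq)
  also have "\<dots> = (\<Sum>l\<le>n. if l = 0 then (-1) ^ n * P 0 else 0)"
  proof (rule sum.cong[OF refl])
    fix l
    \<comment> \<open>For fixed \<open>l = i + j\<close> the coefficients form an alternating
      binomial row sum over \<open>l!\<close>, which is zero unless \<open>l = 0\<close>.\<close>
    have "(\<Sum>i\<le>l. g i (l - i)) = (-1) ^ n * P l / fact l * (\<Sum>i\<le>l. (-1) ^ i * of_nat (l choose i))"
      unfolding sum_distrib_left
      by (rule sum.cong) (auto simp: g_def binomial_fact power_add field_simps)
    thus "(\<Sum>i\<le>l. g i (l - i)) = (if l = 0 then (-1) ^ n * P 0 else 0)"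
      by (simp add: choose_alternating_sum)
  qed
  also have "\<dots> = (-1) ^ n * form vac (Y b (2 * int n - 1) v)"
    by (simp add: P_def)
  finally show ?thesis by simp
qed

subsection \<open>Traces in dual bases\<close>

context
  fixes B :: "nat \<Rightarrow> 'v set" and dual :: "'v \<Rightarrow> 'v"
  assumes basis: "graded_basis scale V B" and dual: "dual_basis form V B dual"
begin

lemma basis_grade: "u \<in> B n \<Longrightarrow> u \<in> V n"
  using basis span_superset unfolding graded_basis_def by blast

lemma dual_grade: "u \<in> B n \<Longrightarrow> dual u \<in> V n"
  using dual by (simp add: dual_basis_def)

lemma finite_basis: "finite (B n)"
proof -
  obtain S where "finite S" "span S = V n"
    using grade_finite_dim by blast
  with basis show ?thesis
    unfolding graded_basis_def by (metis independent_span_bound span_superset)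
qed

lemma card_basis: "card (B n) = dim (V n)"
  using basis dim_span_eq_card_independent unfolding graded_basis_def by metis

lemma basis_expansion:
  assumes "x \<in> V n"
  shows "x = (\<Sum>u\<in>B n. scale (form x (dual u)) u)"
proof -
  have "x \<in> span (B n)"
    using basis assms by (simp add: graded_basis_def)
  then obtain g where x: "x = (\<Sum>u\<in>B n. scale (g u) u)"
    using span_finite[OF finite_basis] by auto
  have "form x (dual v) = g v" if "v \<in> B n" for v
  proof -
    have "form x (dual v) = (\<Sum>u\<in>B n. g u * form u (dual v))"
      by (simp add: x module_hom.sum[OF form_left_hom] module_hom.scale[OF form_left_hom])
    also have "\<dots> = (\<Sum>u\<in>B n. if u = v then g u else 0)"
      using dual that by (intro sum.cong) (auto simp: dual_basis_def)
    finally show ?thesis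
      using that finite_basis by simp
  qed
  thus ?thesis using x by simp
qed

text \<open>Cyclicity of the trace for maps between two grades: pairing with \<open>dual u\<close>
  extracts the coefficient at \<open>u\<close>, and expanding in the basis of the other grade gives
  a double sum whose order can be swapped.\<close>

lemma trace_commute:
  assumes S: "module_hom scale scale S" "\<And>x. x \<in> V n \<Longrightarrow> S x \<in> V m"
    and T: "module_hom scale scale T" "\<And>x. x \<in> V m \<Longrightarrow> T x \<in> V n"
  shows "(\<Sum>u\<in>B n. form (T (S u)) (dual u)) = (\<Sum>v\<in>B m. form (S (T v)) (dual v))"
proof -
  have expand: "form (F x) (dual u) = (\<Sum>v\<in>B k. form x (dual v) * form (F v) (dual u))"
    if "x \<in> V k" "module_hom scale scale F" for x k F u
    by (subst (1) basis_expansion[OF that(1)])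
      (simp add: module_hom.sum[OF that(2)] module_hom.scale[OF that(2)]
        module_hom.sum[OF form_left_hom] module_hom.scale[OF form_left_hom])
  have "(\<Sum>u\<in>B n. form (T (S u)) (dual u))
      = (\<Sum>u\<in>B n. \<Sum>v\<in>B m. form (S u) (dual v) * form (T v) (dual u))"
    by (intro sum.cong refl expand S T basis_grade)
  also have "\<dots> = (\<Sum>v\<in>B m. \<Sum>u\<in>B n. form (T v) (dual u) * form (S u) (dual v))"
    by (subst sum.swap) (simp add: mult.commute)
  also have "\<dots> = (\<Sum>v\<in>B m. form (S (T v)) (dual v))"
    by (intro sum.cong refl expand[symmetric] S T basis_grade)
  finally show ?thesis .
qed

definition raise_lower_trace :: "nat \<Rightarrow> nat \<Rightarrow> complex" where
  "raise_lower_trace n j = (\<Sum>u\<in>B n. form ((L (-1) ^^ j) ((L 1 ^^ j) u)) (dual u))"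

lemma raise_lower_trace_0_right: "raise_lower_trace n 0 = of_nat (dim (V n))"
proof -
  have "raise_lower_trace n 0 = (\<Sum>u\<in>B n. 1)"
    unfolding raise_lower_trace_def using dual by (intro sum.cong) (auto simp: dual_basis_def)
  thus ?thesis by (simp add: card_basis)
qed

lemma raise_lower_trace_eq_0:
  assumes "n < j"
  shows "raise_lower_trace n j = 0"
  unfolding raise_lower_trace_def
  by (rule sum.neutral)
    (simp add: lower_power_eq_0[OF basis_grade assms] module_hom.zero[OF virasoro_mode_power_hom]
      module_hom.zero[OF form_left_hom])

text \<open>Cyclicity brings the rightmost \<open>L(1)\<close> to the front and moves the trace to
  \<open>V n\<close>. Commuting it through \<open>L(-1)^(j+1)\<close>, applied to
  \<open>L(1)^j v\<close> of weight \<open>n - j\<close>, yields the factor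
  \<open>(j + 1) (2 (n - j) + j)\<close>.\<close>

lemma raise_lower_trace_Suc:
  "raise_lower_trace (Suc n) (Suc j)
    = raise_lower_trace n (Suc j) + of_nat (Suc j) * (2 * of_nat n - of_nat j) * raise_lower_trace n j"
proof (cases "j \<le> n")
  case False
  thus ?thesis by (simp add: raise_lower_trace_eq_0)
next
  case True
  define T where "T v = (L (-1) ^^ Suc j) ((L 1 ^^ j) v)" for v
  have "module_hom scale scale T"
    using module_hom_compose[OF virasoro_mode_power_hom[of 1 j] virasoro_mode_power_hom[of "-1" "Suc j"]]
    by (simp add: T_def[abs_def] o_def)
  moreover have "T v \<in> V (Suc n)" if "v \<in> V n" for v
    using raise_power_grade[OF lower_power_grade[OF that True], of "Suc j"] True
    by (simp add: T_def del: funpow.simps)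
  ultimately have "(\<Sum>u\<in>B (Suc n). form (T (L 1 u)) (dual u)) = (\<Sum>v\<in>B n. form (L 1 (T v)) (dual v))"
    by (intro trace_commute virasoro_mode_hom lower_grade) simp
  moreover have "form (L 1 (T v)) (dual v) = form ((L (-1) ^^ Suc j) ((L 1 ^^ Suc j) v)) (dual v)
      + of_nat (Suc j) * (2 * of_nat n - of_nat j) * form ((L (-1) ^^ j) ((L 1 ^^ j) v)) (dual v)"
    if "v \<in> B n" for v
  proof -
    have "2 * of_nat (n - j) + of_nat j = (2 * of_nat n - of_nat j :: complex)"
      using True by (simp add: of_nat_diff)
    thus ?thesis
      using lower_raise_power[OF lower_power_grade[OF basis_grade[OF that] True], of j]
      by (simp add: T_def module_hom.add[OF form_left_hom] module_hom.scale[OF form_left_hom]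
          del: funpow.simps of_nat_Suc) simp
  qed
  moreover have "T (L 1 u) = (L (-1) ^^ Suc j) ((L 1 ^^ Suc j) u)" for u
    by (simp add: T_def funpow_swap1)
  ultimately show ?thesis
    by (simp add: raise_lower_trace_def sum.distrib sum_distrib_left del: funpow.simps of_nat_Suc)
qed

lemma sum_form_vac_basis_dual:
  "(-1) ^ n * (\<Sum>u\<in>B n. form vac (Y u (2 * int n - 1) (dual u)))
    = (\<Sum>k\<le>n. of_nat (dim (V k)) * (catalan_series ^ k) $ n)"
proof -
  have "(-1) ^ n * (\<Sum>u\<in>B n. form vac (Y u (2 * int n - 1) (dual u)))
      = (\<Sum>u\<in>B n. \<Sum>j\<le>n. form ((L (-1) ^^ j) ((L 1 ^^ j) u)) (dual u) / (fact j)^2)"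
    by (simp add: sum_distrib_left form_vac_mode_eq_sum basis_grade dual_grade)
  also have "\<dots> = (\<Sum>j\<le>n. raise_lower_trace n j / (fact j)^2)"
    by (subst sum.swap) (simp add: raise_lower_trace_def sum_divide_distrib)
  also have "\<dots> = (\<Sum>k\<le>n. raise_lower_trace k 0 * (catalan_series ^ k) $ n)"
    by (rule sum_eq_sum_catalan_power[OF raise_lower_trace_eq_0 raise_lower_trace_Suc]) simp
  finally show ?thesis
    by (simp only: raise_lower_trace_0_right)
qed

section \<open>The sewn partition function\<close>

lemma sewn_partition_function_nth:
  "sewn_partition_function form Y vac B dual w $ n
    = (\<Sum>u\<in>B n. form vac (Y u (2 * int n - 1) (dual u))) * w powi (- 2 * int n)"
proof -
  have "expand_at w (\<lambda>m. two_point form Y vac u (dual u) m 0) 0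
      = form vac (Y u (2 * int n - 1) (dual u)) * w powi (- 2 * int n)" if u: "u \<in> B n" for u
  proof -
    \<comment> \<open>Exponent 0 of \<open>z1\<close> selects \<open>dual u\<close> by creation;
      exponent 0 of \<open>z2\<close> is evaluation at \<open>w\<close>.\<close>
    have "expand_at w (\<lambda>m. two_point form Y vac u (dual u) m 0) 0
        = Sum_any (\<lambda>m. form vac (Y u (- m - 1) (dual u)) * w powi m)"
      by (simp add: expand_at_def two_point_def creation)
    also have "\<dots> = (\<Sum>m\<in>{- 2 * int n}. form vac (Y u (- m - 1) (dual u)) * w powi m)"
    proof (rule Sum_any.expand_superset)
      \<comment> \<open>The excluded case, mode -1 at weight 0, is \<open>m = 0 = -2n\<close> and so
        does not occur here.\<close>
      have "form vac (Y u (- m - 1) (dual u)) = 0" if "m \<noteq> - 2 * int n" for m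
        using that by (intro form_vac_mode_eq_0[OF basis_grade[OF u] dual_grade[OF u]]) auto
      thus "{m. form vac (Y u (- m - 1) (dual u)) * w powi m \<noteq> 0} \<subseteq> {- 2 * int n}"
        by auto
    qed simp
    finally show ?thesis by simp
  qed
  thus ?thesis
    by (simp add: sewn_partition_function_def formal_residue_def times_monomial_def sum_distrib_right)
qed

lemma sewn_partition_function_eq:
  assumes "w \<noteq> 0"
  shows "sewn_partition_function form Y vac B dual w =
    graded_dimension scale V oo (catalan_series oo (fps_const (- 1 / w ^ 2) * fps_X))"
proof (rule fps_ext)
  fix n
  have "(catalan_series oo (fps_const (- 1 / w ^ 2) * fps_X)) ^ k $ n
      = (- 1 / w ^ 2) ^ n * (catalan_series ^ k) $ n" for k
    by (subst fps_compose_power) simp_all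
  hence "(graded_dimension scale V oo (catalan_series oo (fps_const (- 1 / w ^ 2) * fps_X))) $ n
      = (- 1 / w ^ 2) ^ n * (\<Sum>k\<le>n. of_nat (dim (V k)) * (catalan_series ^ k) $ n)"
    by (simp add: fps_compose_nth graded_dimension_def sum_distrib_left mult_ac atMost_atLeast0)
  also have "\<dots> = ((- 1 / w ^ 2) ^ n * (-1) ^ n) * (\<Sum>u\<in>B n. form vac (Y u (2 * int n - 1) (dual u)))"
    by (simp only: sum_form_vac_basis_dual[symmetric] mult.assoc)
  \<comment> \<open>The sign \<open>(-1)^n\<close> from the adjoint cancels the one in
    \<open>\<chi> = -\<rho> / w^2\<close>.\<close>
  also have "(- 1 / w ^ 2) ^ n * (-1) ^ n = w powi (- 2 * int n)"
    using assms by (simp add: power_int_minus power_int_mult field_simps flip: power_mult_distrib)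
      (simp add: mult.commute flip: power_mult)
  finally show "sewn_partition_function form Y vac B dual w $ n
      = (graded_dimension scale V oo (catalan_series oo (fps_const (- 1 / w ^ 2) * fps_X))) $ n"
    by (simp add: sewn_partition_function_nth mult.commute)
qed

end

end

theorem theorem5p4:
  fixes scale :: "complex \<Rightarrow> 'v::ab_group_add \<Rightarrow> 'v"
    and V :: "nat \<Rightarrow> 'v set"
    and Y :: "'v \<Rightarrow> int \<Rightarrow> 'v \<Rightarrow> 'v"
    and vac \<omega> :: 'v
    and c :: complex
    and form :: "'v \<Rightarrow> 'v \<Rightarrow> complex"
    and B :: "nat \<Rightarrow> 'v set"
    and dual :: "'v \<Rightarrow> 'v"
    and w :: complex
  assumes "vertex_operator_algebra scale V Y vac \<omega> c"
    and "V 0 = module.span scale {vac}"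
    and "li_zamolodchikov_metric scale V Y vac \<omega> c form"
    and "nondegenerate form"
    and "graded_basis scale V B"
    and "dual_basis form V B dual"
    and "w \<noteq> 0"
  shows "catalan_series = Abs_fps (\<lambda>n. 1 / of_nat n * of_nat ((2 * n) choose (n + 1))) \<and>
         sewn_partition_function form Y vac B dual w =
           graded_dimension scale V oo (catalan_series oo (fps_const (- 1 / w ^ 2) * fps_X))"
proof -
  interpret li_zamolodchikov_metric scale V Y vac \<omega> c form
    by (rule assms(3))
  interpret nondegenerate_li_zamolodchikov_metric scale V Y vac \<omega> c form
    by unfold_locales (fact assms(4) assms(2))+
  show ?thesis
    using catalan_series_closed_form sewn_partition_function_eq[OF assms(5-7)] by blast
qed

end
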